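(* Let $\Sigma_1,\Sigma_2$ be deterministic systems $\dot x_i=A_ix_i+B_iu_i$, $y_i=C_ix_i$ with $A_i$ Hurwitz, and let $G_i(s)=C_i(sI-A_i)^{-1}B_i$, $i=1,2$. Let $\gamma,\delta>0$. If $\Sigma_2$ is $(\gamma,\delta)$-similar to $\Sigma_1$ (or equivalently, $\Sigma_1$ is $(\gamma,\delta)$-similar to $\Sigma_2$), then: (a) $\|G_i\|_\infty<(\gamma+\delta)^{1/2}$ for $i=1,2$; (b) $\|G_1-G_2\|_\infty<(2\delta)^{1/2}$.
   Context: The systems have real constant matrices, states $x_i\in\mathbb{R}^{n_i}$, inputs $u_i\in\mathbb{R}^m$ and outputs $y_i\in\mathbb{R}^p$ (same $m$ and $p$ for both systems). $\mathcal{L}_2$ is the space of measurable (vector-valued) functions $u$ on $[0,\infty)$ with $\|u\|^2=\int_0^\infty|u(t)|^2\,dt<\infty$. $y_i(t;t_0,x_{i,0},u_i)$ denotes the output at time $t$ for $x_i(t_0)=x_{i,0}$ and input $u_i$. For deterministic systems and $\gamma,\delta>0$, $\Sigma_2$ is $(\gamma,\delta)$-similar to $\Sigma_1$ if there exists $\varepsilon>0$ such that for all $u_1,u_2\in\mathcal{L}_2$ $$\|y_1-y_2\|^2\le\gamma\|u_1-u_2\|^2+(\delta-\varepsilon)\left\|\begin{bmatrix}u_1 \\ u_2\end{bmatrix}\right\|^2,\qquad y_i(t)=y_i(t;0,0,u_i).$$ The $H_\infty$ norm is $\|G\|_\infty=\sup_{\omega\in\mathbb{R}}\sigma_{\max}(G(\mathrm{i}\omega))$,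 with $\sigma_{\max}$ the largest singular value. *)

theory Defs
  imports "HOL-Analysis.Analysis"
begin

section \<open>Signals on the half-line\<close>

definition in_L2 :: "(real \<Rightarrow> 'a::real_normed_vector) \<Rightarrow> bool" where
  "in_L2 u \<longleftrightarrow> u \<in> borel_measurable (lebesgue_on {0..}) \<and>
     set_integrable lebesgue {0..} (\<lambda>t. (norm (u t))\<^sup>2)"

text \<open>Meaningful only for signals satisfying \<^const>\<open>in_L2\<close>.\<close>

definition L2_norm :: "(real \<Rightarrow> 'a::real_normed_vector) \<Rightarrow> real" where
  "L2_norm u = sqrt (LINT t:{0..}|lebesgue. (norm (u t))\<^sup>2)"


section \<open>Linear time-invariant systems\<close>

text \<open>A triple \<open>(A, B, C)\<close> stands for the system \<open>x' = A x + B u\<close>, \<open>y = C x\<close>.\<close>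

type_synonym ('n, 'm, 'p) lti = "(real^'n^'n) \<times> (real^'m^'n) \<times> (real^'n^'p)"

text \<open>
  Inputs are merely measurable, so the differential equation is understood in the sense of
  Caratheodory: the state is an absolutely continuous function satisfying the integrated equation.
\<close>

definition lti_state ::
  "real^'n^'n \<Rightarrow> real^'m^'n \<Rightarrow> real \<Rightarrow> real^'n \<Rightarrow> (real \<Rightarrow> real^'m) \<Rightarrow> (real \<Rightarrow> real^'n) \<Rightarrow> bool" where
  "lti_state A B t0 x0 u x \<longleftrightarrow>
     (\<forall>t\<ge>t0. (\<lambda>s. A *v x s + B *v u s) absolutely_integrable_on {t0..t} \<and>
        x t = x0 + integral {t0..t} (\<lambda>s. A *v x s + B *v u s))"

text \<open>
  \<open>lti_output \<Sigma> t0 x0 u y\<close> says that \<open>y\<close> is the output on \<open>[t0, \<infinity>)\<close> for the initial condition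
  \<open>x(t0) = x0\<close> and the input \<open>u\<close>; on that interval it is unique.
\<close>

fun lti_output ::
  "('n::finite, 'm::finite, 'p::finite) lti \<Rightarrow> real \<Rightarrow> real^'n \<Rightarrow> (real \<Rightarrow> real^'m) \<Rightarrow> (real \<Rightarrow> real^'p) \<Rightarrow> bool" where
  "lti_output (A, B, C) t0 x0 u y \<longleftrightarrow>
     (\<exists>x. lti_state A B t0 x0 u x \<and> (\<forall>t\<ge>t0. y t = C *v x t))"

text \<open>
  \<open>similar \<gamma> \<delta> \<Sigma>2 \<Sigma>1\<close>: \<open>\<Sigma>2\<close> is \<open>(\<gamma>, \<delta>)\<close>-similar to \<open>\<Sigma>1\<close>. The conjunct \<open>in_L2 (y1 - y2)\<close> expresses that
  the left-hand side of the inequality is finite. The product norm is Euclidean, so the pair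
  \<open>(u1 t, u2 t)\<close> is the stacked vector.
\<close>

definition similar ::
  "real \<Rightarrow> real \<Rightarrow> ('n2::finite, 'm::finite, 'p::finite) lti \<Rightarrow> ('n1::finite, 'm, 'p) lti \<Rightarrow> bool" where
  "similar \<gamma> \<delta> \<Sigma>2 \<Sigma>1 \<longleftrightarrow>
     (\<exists>\<epsilon>>0. \<forall>u1 u2 y1 y2.
        in_L2 u1 \<longrightarrow> in_L2 u2 \<longrightarrow> lti_output \<Sigma>1 0 0 u1 y1 \<longrightarrow> lti_output \<Sigma>2 0 0 u2 y2 \<longrightarrow>
        in_L2 (\<lambda>t. y1 t - y2 t) \<and>
        (L2_norm (\<lambda>t. y1 t - y2 t))\<^sup>2
          \<le> \<gamma> * (L2_norm (\<lambda>t. u1 t - u2 t))\<^sup>2 + (\<delta> - \<epsilon>) * (L2_norm (\<lambda>t. (u1 t, u2 t)))\<^sup>2)"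


section \<open>Spectra, transfer functions and the H-infinity norm\<close>

abbreviation cmatrix :: "real^'n^'m \<Rightarrow> complex^'n^'m" where
  "cmatrix \<equiv> map_matrix complex_of_real"

definition eigenvalue :: "complex^'n^'n \<Rightarrow> complex \<Rightarrow> bool" where
  "eigenvalue M z \<longleftrightarrow> (\<exists>v. v \<noteq> 0 \<and> M *v v = z *s v)"

definition hurwitz :: "real^'n^'n \<Rightarrow> bool" where
  "hurwitz A \<longleftrightarrow> (\<forall>z. eigenvalue (cmatrix A) z \<longrightarrow> Re z < 0)"

fun transfer_function ::
  "('n::finite, 'm::finite, 'p::finite) lti \<Rightarrow> complex \<Rightarrow> complex^'m^'p" where
  "transfer_function (A, B, C) s = cmatrix C ** matrix_inv (mat s - cmatrix A) ** cmatrix B"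

definition conj_transpose :: "complex^'n^'m \<Rightarrow> complex^'m^'n" where
  "conj_transpose M = map_matrix cnj (transpose M)"

text \<open>
  Singular values are the square roots of the eigenvalues of \<open>M\<^sup>* M\<close>. When \<open>M\<close> has more columns than rows
  this may add zeros to the usual list of \<open>min m p\<close> values, which does not affect the largest one.
\<close>

definition singular_values :: "(complex^'n^'m) \<Rightarrow> real set" where
  "singular_values M = {\<sigma>. \<sigma> \<ge> 0 \<and> eigenvalue (conj_transpose M ** M) (complex_of_real (\<sigma>\<^sup>2))}"

definition sigma_max :: "complex^'n^'m \<Rightarrow> real" where
  "sigma_max M = Max (singular_values M)"

text \<open>Extended real, so that the supremum is meaningful without a boundedness condition.\<close>

definition hinf_norm :: "(complex \<Rightarrow> complex^'n^'m) \<Rightarrow> ereal" where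
  "hinf_norm G = (SUP \<omega>::real. ereal (sigma_max (G (\<i> * complex_of_real \<omega>))))"

end

theory Submission
  imports Defs "HOL-Computational_Algebra.Fundamental_Theorem_Algebra"
begin

text \<open>
  Similarity is symmetric because the norms of \<open>y1 - y2\<close>, \<open>u1 - u2\<close> and \<open>(u1, u2)\<close> are. The bounds follow from
  a frequency-domain version of the similarity inequality (lemma \<open>frequency_domain_similarity\<close>): for
  every frequency \<open>\<omega>\<close> and all complex vectors \<open>v1\<close>, \<open>v2\<close>,

    \<open>|G1(\<i> \<omega>) v1 - G2(\<i> \<omega>) v2|\<^sup>2 \<le> \<gamma> |v1 - v2|\<^sup>2 + (\<delta> - \<epsilon>) (|v1|\<^sup>2 + |v2|\<^sup>2)\<close>.

  The pairs \<open>(v, 0)\<close>, \<open>(0, v)\<close> and \<open>(v, v)\<close> give \<open>|G1(\<i> \<omega>) v|\<^sup>2 \<le> (\<gamma> + \<delta> - \<epsilon>) |v|\<^sup>2\<close>, the same for \<open>G2\<close>,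
  and \<open>|(G1 - G2)(\<i> \<omega>) v|\<^sup>2 \<le> 2 (\<delta> - \<epsilon>) |v|\<^sup>2\<close>. The margin \<open>\<epsilon>\<close> is uniform in \<open>\<omega>\<close>, so the suprema satisfy
  the strict inequalities.

  No Fourier transform is needed for the frequency-domain inequality. The inputs are the real and the
  imaginary parts of \<open>exp (\<i> \<omega> t) v1\<close> and \<open>exp (\<i> \<omega> t) v2\<close>, switched off at time \<open>T\<close>. Summed over the two
  parts, the right-hand side of the similarity inequality is exactly \<open>T\<close> times the right-hand side
  above. On \<open>[0, T]\<close> the output difference is \<open>exp (\<i> \<omega> t) w\<close>, with \<open>w = G1(\<i> \<omega>) v1 - G2(\<i> \<omega>) v2\<close>, up to an
  exponentially decaying transient, so its energy is at least \<open>T |w|\<^sup>2 - O(1)\<close>. Dividing by \<open>T\<close> and letting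
  \<open>T\<close> tend to infinity gives the claim.

  The transient decays because \<open>A\<close> is Hurwitz (lemma \<open>free_motion_decay\<close>). Instead of a normal form of \<open>A\<close>,
  the proof uses a nonzero polynomial \<open>p\<close> with \<open>p(A) = 0\<close> and removes its roots one at a time, each time
  solving a scalar equation. Finally, \<open>sigma_max\<close> is a maximum over a set that has to be shown finite
  and nonempty before it can be bounded (lemma \<open>sigma_max_le\<close>).
\<close>

section \<open>Polynomials in a square matrix\<close>

text \<open>
  The vector \<open>p(A) x\<close>, evaluated by Horner's scheme.
\<close>

definition poly_apply :: "complex^'n^'n \<Rightarrow> complex poly \<Rightarrow> complex^'n \<Rightarrow> complex^'n" where
  "poly_apply A p x = fold_coeffs (\<lambda>a w. a *s x + A *v w) p 0"

lemma poly_apply_0 [simp]: "poly_apply A 0 x = 0"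
  by (simp add: poly_apply_def)

lemma poly_apply_pCons [simp]: "poly_apply A (pCons a p) x = a *s x + A *v poly_apply A p x"
  by (cases "p = 0 \<and> a = 0") (auto simp: poly_apply_def)

lemma poly_apply_add: "poly_apply A (p + q) x = poly_apply A p x + poly_apply A q x"
  by (induction p q rule: poly_induct2)
    (simp_all add: matrix_vector_right_distrib vector_sadd_rdistrib algebra_simps)

lemma poly_apply_smult: "poly_apply A (smult c p) x = c *s poly_apply A p x"
  by (induction p)
    (simp_all add: vector_add_ldistrib vector_smult_assoc vector_scalar_commute)

lemma poly_apply_sum: "poly_apply A (\<Sum>i\<in>I. p i) x = (\<Sum>i\<in>I. poly_apply A (p i) x)"
  by (induction I rule: infinite_finite_induct) (simp_all add: poly_apply_add)

lemma poly_apply_monom: "poly_apply A (monom a k) x = a *s (((*v) A ^^ k) x)"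
  by (induction k) (simp_all add: monom_0 monom_Suc vector_scalar_commute)

lemma poly_apply_linear_factor:
  "poly_apply A ([:-z, 1:] * q) x = A *v poly_apply A q x - z *s poly_apply A q x"
proof -
  have "[:-z, 1:] * q = pCons 0 q + smult (-z) q"
    by simp
  then show ?thesis
    by (simp only: poly_apply_add poly_apply_smult poly_apply_pCons) simp
qed

lemma poly_apply_linear_factor_commute:
  "poly_apply A ([:-z, 1:] * q) x = poly_apply A q (A *v x - z *s x)"
proof -
  have "A *v poly_apply A q x - z *s poly_apply A q x = poly_apply A q (A *v x - z *s x)"
  proof (induction q)
    case (pCons a q)
    then show ?case
      by (simp add: algebra_simps matrix_vector_right_distrib matrix_vector_mult_diff_distrib
          vector_add_ldistrib vector_ssub_ldistrib vector_scalar_commute vector_smult_assoc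
          flip: pCons.IH)
  qed simp
  then show ?thesis
    by (simp only: poly_apply_linear_factor)
qed

text \<open>
  Indexing by \<open>k\<close> instead of by the vectors themselves also covers families with repetitions, where the
  image set may be independent.
\<close>

lemma nontrivial_linear_relation:
  fixes f :: "nat \<Rightarrow> 'a::euclidean_space"
  assumes "DIM('a) \<le> N"
  obtains c :: "nat \<Rightarrow> real" and j where "(\<Sum>k\<le>N. c k *\<^sub>R f k) = 0" "j \<le> N" "c j \<noteq> 0"
proof (cases "inj_on f {..N}")
  case True
  have "card (f ` {..N}) = Suc N"
    using True by (simp add: card_image)
  then have "dependent (f ` {..N})"
    using assms dependent_biggerset[of "f ` {..N}"] by simp
  then obtain u v where u: "(\<Sum>v\<in>f ` {..N}. u v *\<^sub>R v) = 0" "v \<in> f ` {..N}" "u v \<noteq> 0"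
    by (auto simp: dependent_finite)
  have "(\<Sum>k\<le>N. u (f k) *\<^sub>R f k) = 0"
    using u(1) True by (simp add: sum.reindex)
  moreover obtain j where "j \<le> N" "v = f j"
    using u(2) by auto
  ultimately show ?thesis
    using u(3) that[of "u \<circ> f" j] by auto
next
  case False
  then obtain i j where ij: "i \<le> N" "j \<le> N" "i \<noteq> j" "f i = f j"
    by (auto simp: inj_on_def)
  let ?c = "\<lambda>k. (if k = i then 1 else 0) - (if k = j then 1 else 0) :: real"
  have "(\<Sum>k\<le>N. ?c k *\<^sub>R f k) = (\<Sum>k\<le>N. if k = i then f k else 0) - (\<Sum>k\<le>N. if k = j then f k else 0)"
    by (simp add: scaleR_left_diff_distrib sum_subtractf if_distrib[of "\<lambda>r. r *\<^sub>R _"] cong: if_cong)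
  also have "\<dots> = 0"
    using ij by (simp add: sum.delta)
  finally show ?thesis
    using that[of ?c i] ij by simp
qed

text \<open>
  A weak form of the Cayley-Hamilton theorem, obtained by counting dimensions in the space of
  matrices: the degree of the polynomial does not matter below.
\<close>

lemma annihilating_polynomial_exists:
  fixes A :: "complex^'n^'n"
  obtains p where "p \<noteq> 0" "\<And>x. poly_apply A p x = 0"
proof -
  define N where "N = DIM(complex^'n^'n)"
  obtain c j where c: "(\<Sum>k\<le>N. c k *\<^sub>R (((**) A ^^ k) (mat 1))) = 0" "j \<le> N" "c j \<noteq> 0"
    using nontrivial_linear_relation[of N "\<lambda>k. ((**) A ^^ k) (mat 1)"] N_def by blast
  define p where "p = (\<Sum>k\<le>N. monom (complex_of_real (c k)) k)"
  have pow: "(((**) A ^^ k) (mat 1)) *v x = ((*v) A ^^ k) x" for k x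
    by (induction k) (simp_all flip: matrix_vector_mul_assoc)
  have smult: "(r *\<^sub>R M) *v x = complex_of_real r *s (M *v x)" for r x and M :: "complex^'n^'n"
    by (simp add: vec_eq_iff matrix_vector_mult_def scaleR_sum_right flip: scaleR_conv_of_real)
  have "poly_apply A p x = 0" for x
  proof -
    have "poly_apply A p x = (\<Sum>k\<le>N. complex_of_real (c k) *s (((*v) A ^^ k) x))"
      by (simp add: p_def poly_apply_sum poly_apply_monom)
    also have "\<dots> = (\<Sum>k\<le>N. (c k *\<^sub>R (((**) A ^^ k) (mat 1))) *v x)"
      by (simp add: smult pow)
    also have "\<dots> = (\<Sum>k\<le>N. c k *\<^sub>R (((**) A ^^ k) (mat 1))) *v x"
      by (induction N) (simp_all add: matrix_vector_mult_add_rdistrib)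
    finally show ?thesis
      using c(1) by simp
  qed
  moreover have "coeff p j = of_real (c j)"
    using c(2) by (simp add: p_def coeff_sum sum.delta)
  then have "p \<noteq> 0"
    using c(3) by auto
  ultimately show ?thesis
    using that by blast
qed

section \<open>Existence and decay of free motions\<close>

lemma has_vector_derivative_vec_lambda:
  fixes f :: "real \<Rightarrow> 'a::euclidean_space^'n"
  assumes "\<And>i. ((\<lambda>t. f t $ i) has_vector_derivative D $ i) F"
  shows "(f has_vector_derivative D) F"
proof -
  have bl: "bounded_linear (axis i :: 'a \<Rightarrow> 'a^'n)" for i
    unfolding linear_conv_bounded_linear[symmetric]
    by (rule linearI) (auto simp: axis_def vec_eq_iff)
  have eq: "v = (\<Sum>i\<in>UNIV. axis i (v $ i))" for v :: "'a^'n"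
    by (simp add: vec_eq_iff axis_def if_distrib cong: if_cong)
  have "((\<lambda>t. \<Sum>i\<in>UNIV. axis i (f t $ i) :: 'a^'n) has_vector_derivative
      (\<Sum>i\<in>UNIV. axis i (D $ i))) F"
    by (intro has_vector_derivative_sum bounded_linear.has_vector_derivative[OF bl] assms)
  then show ?thesis
    by (simp flip: eq)
qed

text \<open>The solution is the matrix exponential series applied to the initial value.\<close>

lemma free_motion_exists:
  fixes A :: "complex^'n^'n"
  obtains x where "x 0 = z" "\<And>t::real. (x has_vector_derivative A *v x t) (at t)"
proof -
  define w where "w k = ((*v) A ^^ k) z" for k
  define c where "c i k = w k $ i / fact k" for i k
  obtain K where K: "\<And>v. norm (A *v v) \<le> norm v * K" "0 < K"
    using bounded_linear.pos_bounded[OF matrix_vector_mul_bounded_linear[of A]] by blast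
  have w_le: "norm (w k) \<le> K ^ k * norm z" for k
  proof (induction k)
    case (Suc k)
    have "norm (w (Suc k)) \<le> norm (w k) * K"
      using K by (simp add: w_def)
    also have "\<dots> \<le> K ^ k * norm z * K"
      using Suc K by (intro mult_right_mono) auto
    finally show ?case
      by (simp add: algebra_simps)
  qed (simp add: w_def)
  have sm: "summable (\<lambda>k. c i k * s ^ k)" for i s
  proof (rule summable_comparison_test')
    show "summable (\<lambda>k. norm z * (inverse (fact k) * (K * norm s) ^ k))"
      by (intro summable_mult summable_exp)
    show "norm (c i k * s ^ k) \<le> norm z * (inverse (fact k) * (K * norm s) ^ k)" if "0 \<le> k" for k
    proof -
      have "norm (w k $ i) \<le> K ^ k * norm z"
        using w_le[of k] Finite_Cartesian_Product.norm_nth_le[of "w k" i] by linarith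
      then have "norm (w k $ i) * (norm s ^ k / fact k) \<le> K ^ k * norm z * (norm s ^ k / fact k)"
        by (rule mult_right_mono) simp
      then show ?thesis
        by (simp add: c_def norm_mult norm_divide norm_power power_mult_distrib field_simps)
    qed
  qed
  define x where "x t = (\<chi> i. \<Sum>k. c i k * of_real t ^ k)" for t :: real
  have c_Suc: "diffs (c i) k = (\<Sum>j\<in>UNIV. A $ i $ j * c j k)" for i k
  proof -
    have "diffs (c i) k = w (Suc k) $ i / fact k"
      unfolding diffs_def c_def by (simp add: field_simps del: of_nat_Suc)
    also have "\<dots> = (\<Sum>j\<in>UNIV. A $ i $ j * c j k)"
      by (simp add: w_def c_def matrix_vector_mult_def sum_divide_distrib)
    finally show ?thesis .
  qed
  have "(x has_vector_derivative A *v x t) (at t)" for t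
  proof (rule has_vector_derivative_vec_lambda)
    fix i
    have "((\<lambda>s. \<Sum>k. c i k * s ^ k) has_field_derivative (\<Sum>k. diffs (c i) k * of_real t ^ k)) (at (of_real t))"
      by (rule termdiffs_strong_converges_everywhere) (rule sm)
    then have "((\<lambda>t. x t $ i) has_vector_derivative (\<Sum>k. diffs (c i) k * of_real t ^ k)) (at t)"
      unfolding x_def by (auto dest!: has_field_derivative_at_within has_vector_derivative_real_field)
    also have "(\<Sum>k. diffs (c i) k * of_real t ^ k) = (\<Sum>k. \<Sum>j\<in>UNIV. A $ i $ j * (c j k * of_real t ^ k))"
      by (simp add: c_Suc sum_distrib_right mult.assoc)
    also have "\<dots> = (\<Sum>j\<in>UNIV. \<Sum>k. A $ i $ j * (c j k * of_real t ^ k))"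
      by (intro suminf_sum summable_mult sm)
    also have "\<dots> = (A *v x t) $ i"
      by (simp add: matrix_vector_mult_def x_def suminf_mult sm)
    finally show "((\<lambda>t. x t $ i) has_vector_derivative (A *v x t) $ i) (at t)" .
  qed
  moreover have "x 0 = z"
    by (simp add: x_def vec_eq_iff) (simp add: c_def w_def)
  ultimately show ?thesis
    using that by blast
qed

lemma bounded_linear_smult: "bounded_linear (\<lambda>v. c *s v)" for c :: complex
  unfolding linear_conv_bounded_linear[symmetric]
  by (rule linearI) (simp_all add: vec_eq_iff algebra_simps)

lemma norm_smult: "norm (c *s v) = norm c * norm v" for c :: complex
  by (simp add: norm_vec_def L2_set_def norm_mult power_mult_distrib sum_distrib_left[symmetric]
      real_sqrt_mult)

lemma has_vector_derivative_smult:
  fixes f :: "real \<Rightarrow> complex" and g :: "real \<Rightarrow> complex^'n"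
  assumes "(f has_vector_derivative f') (at t)" "(g has_vector_derivative g') (at t)"
  shows "((\<lambda>t. f t *s g t) has_vector_derivative f t *s g' + f' *s g t) (at t)"
proof (rule has_vector_derivative_vec_lambda)
  fix i
  have "((\<lambda>t. g t $ i) has_vector_derivative g' $ i) (at t)"
    using assms(2) by (rule bounded_linear.has_vector_derivative[OF bounded_linear_vec_nth])
  from has_vector_derivative_mult[OF assms(1) this]
  show "((\<lambda>t. (f t *s g t) $ i) has_vector_derivative (f t *s g' + f' *s g t) $ i) (at t)"
    by simp
qed

lemma has_vector_derivative_exp_complex:
  "((\<lambda>t. exp (z * complex_of_real t)) has_vector_derivative z * exp (z * complex_of_real t)) (at t)"
proof -
  have "((\<lambda>s. exp (z * s)) has_field_derivative z * exp (z * complex_of_real t)) (at (complex_of_real t))"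
    by (auto intro!: derivative_eq_intros)
  then show ?thesis
    by (rule has_vector_derivative_real_field)
qed

text \<open>
  The rate \<open>b\<close> is at most \<open>a\<close> and strictly below \<open>- Re z\<close>. Hence the derivative of \<open>y t = exp (- z t) x t\<close>
  grows at most like \<open>exp (m t)\<close> with \<open>m > 0\<close>, so does \<open>y\<close>, and resonance (\<open>a = - Re z\<close>) needs no separate
  treatment.
\<close>

lemma scalar_forcing_decay:
  fixes x g :: "real \<Rightarrow> complex^'n"
  assumes deriv: "\<And>t. (x has_vector_derivative z *s x t + g t) (at t)"
    and "Re z < 0" and g: "\<And>t. t \<ge> 0 \<Longrightarrow> norm (g t) \<le> K * exp (- a * t)" and "a > 0"
  obtains M b where "b > 0" "\<And>t. t \<ge> 0 \<Longrightarrow> norm (x t) \<le> M * exp (- b * t)"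
proof -
  define b where "b = min a (- Re z / 2)"
  have b: "b > 0" "b \<le> a"
    using assms by (auto simp: b_def)
  define m where "m = - Re z - b"
  have "m > 0"
    using \<open>Re z < 0\<close> by (auto simp: m_def b_def)
  have "norm (g 0) \<le> K"
    using g[of 0] by simp
  then have "K \<ge> 0"
    using norm_ge_zero order_trans by blast
  define e where "e t = exp (- z * complex_of_real t)" for t
  have norm_e: "norm (e t) = exp (- Re z * t)" for t
    by (simp add: e_def)
  define y where "y t = e t *s x t" for t
  have y': "(y has_vector_derivative e t *s g t) (at t)" for t
  proof -
    have "(e has_vector_derivative - z * e t) (at t)"
      unfolding e_def by (rule has_vector_derivative_exp_complex)
    from has_vector_derivative_smult[OF this deriv[of t]]
    show ?thesis
      unfolding y_def by (simp add: vec_eq_iff algebra_simps)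
  qed
  have y_le: "norm (y t - y 0) \<le> K / m * exp (m * t) - K / m" if "t > 0" for t
  proof -
    define \<phi> where "\<phi> s = K / m * exp (m * s)" for s
    have "norm (y t - y 0) \<le> \<phi> t - \<phi> 0"
    proof (rule differentiable_bound_general[OF \<open>0 < t\<close>])
      show "continuous_on {0..t} \<phi>"
        unfolding \<phi>_def by (intro continuous_intros)
      show "continuous_on {0..t} y"
        using y' has_vector_derivative_continuous by (metis continuous_at_imp_continuous_on)
      show "(y has_vector_derivative e s *s g s) (at s)" if "0 < s" "s < t" for s
        by (rule y')
      show "(\<phi> has_vector_derivative K * exp (m * s)) (at s)" for s
        using \<open>m > 0\<close> unfolding \<phi>_def has_real_derivative_iff_has_vector_derivative[symmetric]
        by (auto intro!: derivative_eq_intros)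
      show "norm (e s *s g s) \<le> K * exp (m * s)" if "0 < s" "s < t" for s
      proof -
        have "norm (g s) \<le> K * exp (- b * s)"
        proof -
          have "exp (- a * s) \<le> exp (- b * s)"
            using b(2) that by (simp add: mult_right_mono)
          then have "K * exp (- a * s) \<le> K * exp (- b * s)"
            using \<open>K \<ge> 0\<close> by (rule mult_left_mono)
          then show ?thesis
            using g[of s] that by linarith
        qed
        then have "exp (- Re z * s) * norm (g s) \<le> exp (- Re z * s) * (K * exp (- b * s))"
          by (rule mult_left_mono) simp
        also have "\<dots> = K * exp (m * s)"
          by (simp add: m_def algebra_simps flip: exp_add)
        finally show ?thesis
          by (simp only: norm_smult norm_e)
      qed
    qed
    then show ?thesis
      by (simp add: \<phi>_def)
  qed
  have "norm (x t) \<le> (norm (x 0) + K / m) * exp (- b * t)" if "t \<ge> 0" for t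
  proof (cases "t = 0")
    case True
    then show ?thesis
      using \<open>K \<ge> 0\<close> \<open>m > 0\<close> by simp
  next
    case False
    have "K / m \<ge> 0"
      using \<open>K \<ge> 0\<close> \<open>m > 0\<close> by simp
    have "norm (y t) \<le> norm (y 0) + (K / m * exp (m * t) - K / m)"
      using y_le[of t] False that norm_triangle_ineq2[of "y t" "y 0"] by linarith
    also have "y 0 = x 0"
      by (simp add: y_def e_def)
    also have "norm (x 0) + (K / m * exp (m * t) - K / m) \<le> norm (x 0) * exp (m * t) + K / m * exp (m * t)"
      using \<open>K / m \<ge> 0\<close> \<open>m > 0\<close> that mult_left_mono[of 1 "exp (m * t)" "norm (x 0)"] by simp
    finally have "exp (Re z * t) * norm (y t) \<le> exp (Re z * t) * ((norm (x 0) + K / m) * exp (m * t))"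
      by (intro mult_left_mono) (simp_all add: algebra_simps)
    moreover have "exp (Re z * t) * norm (y t) = norm (x t)"
      by (simp add: y_def norm_smult norm_e flip: exp_add mult.assoc)
    moreover have "exp (Re z * t) * ((norm (x 0) + K / m) * exp (m * t)) = (norm (x 0) + K / m) * exp (- b * t)"
      by (simp add: m_def algebra_simps flip: exp_add)
    ultimately show ?thesis
      by linarith
  qed
  with b(1) show ?thesis
    using that by blast
qed

text \<open>
  Induction on the degree of \<open>p\<close>, splitting off one root \<open>z\<close> at a time. If \<open>Re z < 0\<close>, then \<open>(A - z) x\<close> is
  a free motion annihilated by the remaining factor, hence decays, and it drives the scalar equation
  \<open>x' = z x + (A - z) x\<close>.
\<close>

lemma free_motion_decay_if_annihilated:
  fixes x :: "real \<Rightarrow> complex^'n"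
  assumes stable: "\<And>z. eigenvalue A z \<Longrightarrow> Re z < 0"
    and "\<And>t. (x has_vector_derivative A *v x t) (at t)"
    and "p \<noteq> 0" and "\<And>t. poly_apply A p (x t) = 0"
  shows "\<exists>M b. b > 0 \<and> (\<forall>t\<ge>0. norm (x t) \<le> M * exp (- b * t))"
  using assms(2-)
proof (induction "degree p" arbitrary: p x)
  case 0
  then obtain c where "p = [:c:]"
    by (metis degree_eq_zeroE)
  then have "x t = 0" for t
    using "0.prems"(2) "0.prems"(3)[of t] by (simp add: vec_eq_iff)
  then show ?case
    by (intro exI[of _ 1] exI[of _ 0]) simp
next
  case (Suc n)
  then have "\<not> constant (poly p)"
    by (simp add: constant_degree)
  then obtain z where "poly p z = 0"
    using fundamental_theorem_of_algebra by blast
  then obtain q where p: "p = [:-z, 1:] * q"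
    by (metis poly_eq_0_iff_dvd dvdE)
  then have "q \<noteq> 0"
    using \<open>p \<noteq> 0\<close> by auto
  then have deg: "n = degree q"
    using Suc.hyps(2) unfolding p by (subst (asm) degree_mult_eq) auto
  show ?case
  proof (cases "Re z < 0")
    case True
    define g where "g t = A *v x t - z *s x t" for t
    have "bounded_linear (\<lambda>v. A *v v - z *s v)"
      by (intro bounded_linear_sub matrix_vector_mul_bounded_linear bounded_linear_smult)
    from bounded_linear.has_vector_derivative[OF this Suc.prems(1)]
    have "(g has_vector_derivative A *v g t) (at t)" for t
      unfolding g_def by (simp add: matrix_vector_mult_diff_distrib vector_scalar_commute)
    moreover have "poly_apply A q (g t) = 0" for t
      using Suc.prems(3)[of t] unfolding p g_def poly_apply_linear_factor_commute .
    ultimately obtain K a where "a > 0" "\<And>t. t \<ge> 0 \<Longrightarrow> norm (g t) \<le> K * exp (- a * t)"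
      using Suc.hyps(1)[OF deg _ \<open>q \<noteq> 0\<close>] by blast
    moreover have "(x has_vector_derivative z *s x t + g t) (at t)" for t
      using Suc.prems(1)[of t] by (simp add: g_def)
    ultimately show ?thesis
      using scalar_forcing_decay[of x z g K a] True by metis
  next
    case False
    \<comment> \<open>Then \<open>z\<close> is not an eigenvalue, so \<open>A - z\<close> is injective and the factor can be dropped.\<close>
    have "poly_apply A q (x t) = 0" for t
    proof (rule ccontr)
      assume "poly_apply A q (x t) \<noteq> 0"
      moreover have "A *v poly_apply A q (x t) = z *s poly_apply A q (x t)"
        using Suc.prems(3)[of t] unfolding p poly_apply_linear_factor by simp
      ultimately have "eigenvalue A z"
        unfolding eigenvalue_def by blast
      then show False
        using stable False by blast
    qed
    then show ?thesis
      using Suc.hyps(1)[OF deg Suc.prems(1) \<open>q \<noteq> 0\<close>] by blast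
  qed
qed

lemma free_motion_decay:
  fixes x :: "real \<Rightarrow> complex^'n"
  assumes "\<And>z. eigenvalue A z \<Longrightarrow> Re z < 0"
    and "\<And>t. (x has_vector_derivative A *v x t) (at t)"
  obtains M b where "b > 0" "\<And>t. t \<ge> 0 \<Longrightarrow> norm (x t) \<le> M * exp (- b * t)"
proof -
  obtain p where "p \<noteq> 0" "\<And>v. poly_apply A p v = 0"
    using annihilating_polynomial_exists by blast
  then show ?thesis
    using free_motion_decay_if_annihilated[of A x p] assms that by blast
qed

section \<open>Response to a truncated harmonic input\<close>

text \<open>
  Componentwise application of a functional. It is used with the functionals \<open>Re\<close> and \<open>Im\<close> to turn
  complex signals into real ones.
\<close>

definition vmap :: "(complex \<Rightarrow> real) \<Rightarrow> complex^'n \<Rightarrow> real^'n" where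
  "vmap L v = (\<chi> i. L (v $ i))"

lemma bounded_linear_vmap:
  assumes "bounded_linear L"
  shows "bounded_linear (vmap L :: complex^'n \<Rightarrow> real^'n)"
proof -
  interpret L: bounded_linear L by fact
  show ?thesis
    unfolding linear_conv_bounded_linear[symmetric]
    by (rule linearI) (simp_all add: vmap_def vec_eq_iff L.add L.scaleR)
qed

lemma vmap_cmatrix:
  assumes "bounded_linear L"
  shows "vmap L (cmatrix A *v v) = A *v vmap L v"
proof -
  interpret L: bounded_linear L by fact
  show ?thesis
    by (simp add: vmap_def vec_eq_iff matrix_vector_mult_def L.sum L.scaleR
        flip: scaleR_conv_of_real)
qed

text \<open>
  The complex harmonic signal \<open>cis (\<omega> t) v\<close>, switched off after time \<open>T\<close>. Only \<open>t \<ge> 0\<close> matters, so it is not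
  switched off for negative times.
\<close>

definition pulse :: "real \<Rightarrow> real \<Rightarrow> complex^'m \<Rightarrow> real \<Rightarrow> complex^'m" where
  "pulse \<omega> T v t = (if t \<le> T then cis (\<omega> * t) *s v else 0)"

text \<open>
  For a bounded input, a continuous function that satisfies the differential equation outside a
  finite set of times is a state in the sense of Caratheodory; the exceptional set accommodates
  inputs with jumps.
\<close>

lemma lti_state_if_has_vector_derivative:
  fixes A :: "real^'n^'n" and B :: "real^'m^'n"
  assumes cont: "continuous_on {t0..} x" and init: "x t0 = x0"
    and "finite S"
    and deriv: "\<And>t. t > t0 \<Longrightarrow> t \<notin> S \<Longrightarrow> (x has_vector_derivative A *v x t + B *v u t) (at t)"
    and bound: "\<And>t. norm (u t) \<le> k"
  shows "lti_state A B t0 x0 u x"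
  unfolding lti_state_def
proof (intro allI impI)
  fix t assume "t0 \<le> t"
  have cont': "continuous_on {t0..t} x"
    using cont by (rule continuous_on_subset) auto
  have int: "((\<lambda>s. A *v x s + B *v u s) has_integral x t - x t0) {t0..t}"
    using \<open>finite S\<close> \<open>t0 \<le> t\<close> _ cont'
    by (rule fundamental_theorem_of_calculus_interior_strong) (auto intro: deriv)
  obtain K where K: "\<And>v. norm (B *v v) \<le> norm v * K" "0 < K"
    using bounded_linear.pos_bounded[OF matrix_vector_mul_bounded_linear[of B]] by blast
  have "(\<lambda>s. A *v x s + B *v u s) absolutely_integrable_on {t0..t}"
  proof (rule absolutely_integrable_integrable_bound)
    show "norm (A *v x s + B *v u s) \<le> norm (A *v x s) + k * K" for s
      using norm_triangle_ineq[of "A *v x s" "B *v u s"] K(1)[of "u s"]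
        mult_right_mono[OF bound[of s], of K] K(2) by linarith
    show "(\<lambda>s. norm (A *v x s) + k * K) integrable_on {t0..t}"
      by (intro integrable_continuous_real continuous_intros cont'
          bounded_linear.continuous_on[OF matrix_vector_mul_bounded_linear])
  qed (use int in auto)
  with int show "(\<lambda>s. A *v x s + B *v u s) absolutely_integrable_on {t0..t} \<and>
      x t = x0 + integral {t0..t} (\<lambda>s. A *v x s + B *v u s)"
    by (simp add: integral_unique init)
qed

lemma mat_vector_mult: "mat s *v v = s *s (v :: 'a::comm_ring_1^'n)"
  by (simp add: vec_eq_iff matrix_vector_mult_def mat_def if_distrib if_distribR cong: if_cong)

lemma matrix_inv_vector:
  fixes M :: "'a::field^'n^'n"
  assumes "\<And>v. M *v v = 0 \<Longrightarrow> v = 0"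
  shows "M *v (matrix_inv M *v w) = w"
proof -
  have "invertible M"
    using assms by (auto simp: invertible_left_inverse matrix_left_invertible_ker)
  then have "M ** matrix_inv M = mat 1"
    unfolding invertible_def matrix_inv_def by (rule someI2_ex) simp
  then show ?thesis
    by (simp add: matrix_vector_mul_assoc)
qed

lemma has_vector_derivative_cis:
  "((\<lambda>t. cis (\<omega> * t)) has_vector_derivative \<i> * complex_of_real \<omega> * cis (\<omega> * t)) (at t)"
  using has_vector_derivative_exp_complex[of "\<i> * complex_of_real \<omega>" t]
  by (simp add: cis_conv_exp mult.assoc)

text \<open>
  The motion from the zero state under \<open>cis (\<omega> t) v\<close> is the steady state \<open>cis (\<omega> t) z\<close>, with
  \<open>z = (\<i> \<omega> - A)\<^sup>-\<^sup>1 B v\<close>, minus the free motion that starts at \<open>z\<close>.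
\<close>

lemma harmonic_forced_motion:
  fixes A :: "real^'n^'n" and B :: "real^'m^'n" and v :: "complex^'m" and \<omega> :: real
  assumes "hurwitz A"
  defines "z \<equiv> matrix_inv (mat (\<i> * complex_of_real \<omega>) - cmatrix A) *v (cmatrix B *v v)"
  obtains P M b where
    "P 0 = 0"
    "\<And>t. (P has_vector_derivative cmatrix A *v P t + cis (\<omega> * t) *s (cmatrix B *v v)) (at t)"
    "b > 0" "\<And>t. t \<ge> 0 \<Longrightarrow> norm (P t - cis (\<omega> * t) *s z) \<le> M * exp (- b * t)"
proof -
  have stable: "\<And>s. eigenvalue (cmatrix A) s \<Longrightarrow> Re s < 0"
    using assms by (simp add: hurwitz_def)
  have "(mat (\<i> * complex_of_real \<omega>) - cmatrix A) *v z = cmatrix B *v v"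
    unfolding z_def
  proof (rule matrix_inv_vector)
    fix x assume "(mat (\<i> * complex_of_real \<omega>) - cmatrix A) *v x = 0"
    then have "cmatrix A *v x = (\<i> * complex_of_real \<omega>) *s x"
      by (simp add: matrix_vector_mult_diff_rdistrib mat_vector_mult)
    then show "x = 0"
      using stable[of "\<i> * complex_of_real \<omega>"] by (auto simp: eigenvalue_def)
  qed
  then have z: "(\<i> * complex_of_real \<omega>) *s z = cmatrix A *v z + cmatrix B *v v"
    by (simp add: matrix_vector_mult_diff_rdistrib mat_vector_mult algebra_simps)
  obtain E where E: "E 0 = z" "\<And>t. (E has_vector_derivative cmatrix A *v E t) (at t)"
    using free_motion_exists by blast
  obtain M b where decay: "b > 0" "\<And>t. t \<ge> 0 \<Longrightarrow> norm (E t) \<le> M * exp (- b * t)"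
    using free_motion_decay[OF stable E(2)] by blast
  define P where "P t = cis (\<omega> * t) *s z - E t" for t
  have "(P has_vector_derivative cmatrix A *v P t + cis (\<omega> * t) *s (cmatrix B *v v)) (at t)" for t
  proof -
    have "(P has_vector_derivative
        (cis (\<omega> * t) *s 0 + (\<i> * complex_of_real \<omega> * cis (\<omega> * t)) *s z) - cmatrix A *v E t) (at t)"
      unfolding P_def
      by (intro has_vector_derivative_diff has_vector_derivative_smult has_vector_derivative_cis
          has_vector_derivative_const E)
    moreover have "(\<i> * complex_of_real \<omega> * cis (\<omega> * t)) *s z
        = cis (\<omega> * t) *s ((\<i> * complex_of_real \<omega>) *s z)"
      by (simp add: vector_smult_assoc mult_ac)
    then have "(\<i> * complex_of_real \<omega> * cis (\<omega> * t)) *s z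
        = cmatrix A *v (cis (\<omega> * t) *s z) + cis (\<omega> * t) *s (cmatrix B *v v)"
      by (simp only: z vector_add_ldistrib vector_scalar_commute)
    ultimately show ?thesis
      by (simp add: P_def matrix_vector_mult_diff_distrib algebra_simps)
  qed
  moreover have "P 0 = 0"
    by (simp add: P_def E)
  moreover have "norm (P t - cis (\<omega> * t) *s z) \<le> M * exp (- b * t)" if "t \<ge> 0" for t
    using decay(2)[OF that] by (simp add: P_def)
  ultimately show ?thesis
    using that decay(1) by blast
qed

lemma norm_vmap_pulse_bounded:
  assumes "bounded_linear L"
  obtains k where "\<And>t. norm (vmap L (pulse \<omega> T v t)) \<le> k"
proof -
  obtain K where K: "\<And>x. norm (vmap L (x :: complex^'a)) \<le> norm x * K" "0 < K"
    using bounded_linear.pos_bounded[OF bounded_linear_vmap[OF assms]] by blast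
  have "norm (vmap L (pulse \<omega> T v t)) \<le> norm v * K" for t
  proof -
    have "norm (pulse \<omega> T v t) \<le> norm v"
      by (simp add: pulse_def norm_smult)
    then have "norm (pulse \<omega> T v t) * K \<le> norm v * K"
      using K(2) by (intro mult_right_mono) auto
    with K(1) show ?thesis
      by (rule order_trans)
  qed
  then show ?thesis
    using that by blast
qed

text \<open>
  The constants \<open>K\<close> and \<open>b\<close> do not depend on \<open>T\<close>: the total deviation from the steady-state output over
  \<open>[0, T]\<close> stays bounded as \<open>T\<close> grows.
\<close>

lemma pulse_response:
  fixes A :: "real^'n^'n" and B :: "real^'m^'n" and C :: "real^'n^'p" and v :: "complex^'m" and \<omega> :: real
  assumes "hurwitz A"
  obtains K b where "b > 0" "K \<ge> 0"
    "\<And>T. T \<ge> 0 \<Longrightarrow> \<exists>Y. (\<forall>L. bounded_linear L \<longrightarrow>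
              lti_output (A, B, C) 0 0 (\<lambda>t. vmap L (pulse \<omega> T v t)) (\<lambda>t. vmap L (Y t))) \<and>
           (\<forall>t\<in>{0..T}. norm (Y t - cis (\<omega> * t) *s (transfer_function (A, B, C) (\<i> * complex_of_real \<omega>) *v v))
              \<le> K * exp (- b * t))"
proof -
  define z where "z = matrix_inv (mat (\<i> * complex_of_real \<omega>) - cmatrix A) *v (cmatrix B *v v)"
  obtain P M b where P: "P 0 = 0"
    "\<And>t. (P has_vector_derivative cmatrix A *v P t + cis (\<omega> * t) *s (cmatrix B *v v)) (at t)"
    and decay: "b > 0" "\<And>t. t \<ge> 0 \<Longrightarrow> norm (P t - cis (\<omega> * t) *s z) \<le> M * exp (- b * t)"
    unfolding z_def by (rule harmonic_forced_motion[OF assms, where \<omega> = \<omega> and B = B and v = v]) blast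
  obtain K where K: "\<And>x. norm (cmatrix C *v x) \<le> norm x * K" "0 < K"
    using bounded_linear.pos_bounded[OF matrix_vector_mul_bounded_linear[of "cmatrix C"]] by blast
  have "M \<ge> 0"
    using order_trans[OF norm_ge_zero decay(2)[of 0]] by simp
  have P_cont: "continuous_on S P" for S
    using has_vector_derivative_continuous[OF P(2)] by (auto intro: continuous_at_imp_continuous_on)
  have Gv: "transfer_function (A, B, C) (\<i> * complex_of_real \<omega>) *v v = cmatrix C *v z"
    by (simp add: z_def matrix_vector_mul_assoc matrix_mul_assoc)
  have "\<exists>Y. (\<forall>L. bounded_linear L \<longrightarrow>
              lti_output (A, B, C) 0 0 (\<lambda>t. vmap L (pulse \<omega> T v t)) (\<lambda>t. vmap L (Y t))) \<and>
           (\<forall>t\<in>{0..T}. norm (Y t - cis (\<omega> * t) *s (transfer_function (A, B, C) (\<i> * complex_of_real \<omega>) *v v))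
              \<le> (M * K) * exp (- b * t))" if "T \<ge> 0" for T
  proof -
    \<comment> \<open>Switching the input off at time \<open>T\<close> amounts to subtracting the response that starts
      at time \<open>T\<close>; for \<open>t \<le> T\<close> the correction is \<open>P 0 = 0\<close>.\<close>
    define X where "X t = P t - cis (\<omega> * T) *s P (max 0 (t - T))" for t
    have X_cont: "continuous_on S X" for S
      unfolding X_def
      by (intro continuous_intros P_cont bounded_linear.continuous_on[OF bounded_linear_smult]
          continuous_on_compose2[OF P_cont[of UNIV]]) auto
    have X': "(X has_vector_derivative cmatrix A *v X t + cmatrix B *v pulse \<omega> T v t) (at t)"
      if "t \<noteq> T" for t
    proof (cases "t < T")
      case True
      have "(P has_vector_derivative cmatrix A *v X t + cmatrix B *v pulse \<omega> T v t) (at t)"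
        using P(2)[of t] True by (simp add: X_def P(1) pulse_def vector_scalar_commute)
      then show ?thesis
        by (rule has_vector_derivative_transform_within_open[where S = "{..<T}"])
          (use True in \<open>auto simp: X_def P(1)\<close>)
    next
      case False
      then have "t > T"
        using that by simp
      have "((\<lambda>t. P (t - T)) has_vector_derivative
          cmatrix A *v P (t - T) + cis (\<omega> * (t - T)) *s (cmatrix B *v v)) (at t)"
      proof -
        have "((\<lambda>t. t - T) has_vector_derivative 1) (at t)"
          by (auto intro!: derivative_eq_intros)
        from vector_diff_chain_at[OF this P(2)] show ?thesis
          by (simp add: o_def)
      qed
      note bounded_linear.has_vector_derivative[OF bounded_linear_smult this, of "cis (\<omega> * T)"]
      from has_vector_derivative_diff[OF P(2) this]
      have "((\<lambda>t. P t - cis (\<omega> * T) *s P (t - T)) has_vector_derivative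
          cmatrix A *v X t + cmatrix B *v pulse \<omega> T v t) (at t)"
        using \<open>t > T\<close>
        by (simp add: X_def pulse_def matrix_vector_mult_diff_distrib vector_scalar_commute
            vector_add_ldistrib vector_smult_assoc cis_mult algebra_simps)
      then show ?thesis
        by (rule has_vector_derivative_transform_within_open[where S = "{T<..}"])
          (use \<open>t > T\<close> in \<open>auto simp: X_def\<close>)
    qed
    show ?thesis
    proof (intro exI conjI ballI allI impI)
      fix L :: "complex \<Rightarrow> real" assume L: "bounded_linear L"
      obtain k where k: "\<And>t. norm (vmap L (pulse \<omega> T v t)) \<le> k"
        using norm_vmap_pulse_bounded[OF L] by blast
      have "lti_state A B 0 0 (\<lambda>t. vmap L (pulse \<omega> T v t)) (\<lambda>t. vmap L (X t))"
      proof (rule lti_state_if_has_vector_derivative[where S = "{T}"])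
        show "continuous_on {0..} (\<lambda>t. vmap L (X t))"
          by (intro bounded_linear.continuous_on[OF bounded_linear_vmap[OF L]] X_cont)
        show "vmap L (X 0) = 0"
          using that linear_0[OF bounded_linear.linear[OF bounded_linear_vmap[OF L]]] by (simp add: X_def P(1))
        show "((\<lambda>t. vmap L (X t)) has_vector_derivative
            A *v vmap L (X t) + B *v vmap L (pulse \<omega> T v t)) (at t)" if "t \<notin> {T}" for t
          using bounded_linear.has_vector_derivative[OF bounded_linear_vmap[OF L] X'[of t]] that
          by (simp add: vmap_cmatrix[OF L] linear_add[OF bounded_linear.linear[OF bounded_linear_vmap[OF L]]])
      qed (use k in auto)
      then show "lti_output (A, B, C) 0 0 (\<lambda>t. vmap L (pulse \<omega> T v t)) (\<lambda>t. vmap L (cmatrix C *v X t))"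
        by (auto simp: vmap_cmatrix[OF L])
    next
      fix t assume t: "t \<in> {0..T}"
      have "cmatrix C *v X t - cis (\<omega> * t) *s (cmatrix C *v z) = cmatrix C *v (P t - cis (\<omega> * t) *s z)"
        using t by (simp add: X_def P(1) matrix_vector_mult_diff_distrib vector_scalar_commute)
      then have "norm (cmatrix C *v X t - cis (\<omega> * t) *s (cmatrix C *v z)) \<le> norm (P t - cis (\<omega> * t) *s z) * K"
        using K(1) by metis
      also have "\<dots> \<le> M * exp (- b * t) * K"
        using decay(2)[of t] t K(2) by (intro mult_right_mono) auto
      finally show "norm (cmatrix C *v X t - cis (\<omega> * t) *s (transfer_function (A, B, C) (\<i> * complex_of_real \<omega>) *v v))
          \<le> (M * K) * exp (- b * t)"
        by (simp only: Gv mult_ac)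
    qed
  qed
  moreover have "M * K \<ge> 0"
    using \<open>M \<ge> 0\<close> K(2) by simp
  ultimately show ?thesis
    using that[OF decay(1)] by blast
qed

section \<open>Energies and the frequency-domain inequality\<close>

lemma L2_norm_squared: "(L2_norm u)\<^sup>2 = (LINT t:{0..}|lebesgue. (norm (u t))\<^sup>2)"
proof -
  have "0 \<le> (LINT t:{0..}|lebesgue. (norm (u t))\<^sup>2)"
    unfolding set_lebesgue_integral_def by (rule Bochner_Integration.integral_nonneg) simp
  then show ?thesis
    by (simp add: L2_norm_def)
qed

lemma L2_norm_squared_Pair:
  assumes "in_L2 u1" "in_L2 u2"
  shows "(L2_norm (\<lambda>t. (u1 t, u2 t)))\<^sup>2 = (L2_norm u1)\<^sup>2 + (L2_norm u2)\<^sup>2"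
  using assms by (simp add: L2_norm_squared norm_Pair in_L2_def set_integral_add)

lemma norm_vmap_Re_Im: "(norm (vmap Re v))\<^sup>2 + (norm (vmap Im v))\<^sup>2 = (norm v)\<^sup>2"
  by (simp add: norm_vec_def L2_set_def sum_nonneg vmap_def cmod_power2 flip: sum.distrib)

lemma pulse_in_L2:
  fixes v :: "complex^'m"
  assumes "bounded_linear L"
  shows "in_L2 (\<lambda>t. vmap L (pulse \<omega> T v t))"
proof -
  define h where "h t = vmap L (cis (\<omega> * t) *s v)" for t
  have "continuous_on S (\<lambda>t. cis (\<omega> * t) *s v)" for S
    unfolding vector_scalar_mult_def by (intro continuous_intros)
  then have h_cont: "continuous_on S h" for S
    unfolding h_def by (rule bounded_linear.continuous_on[OF bounded_linear_vmap[OF assms]])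
  have "vmap L (0 :: complex^'m) = 0"
    using linear_0[OF bounded_linear.linear[OF bounded_linear_vmap[OF assms]]] .
  then have u: "vmap L (pulse \<omega> T v t) = indicator {..T} t *\<^sub>R h t" for t
    by (simp add: pulse_def h_def)
  have "h \<in> borel_measurable borel"
    using h_cont by (rule borel_measurable_continuous_onI)
  then have "(\<lambda>t. indicator {..T} t *\<^sub>R h t) \<in> borel_measurable lborel"
    by measurable
  then have "(\<lambda>t. indicator {..T} t *\<^sub>R h t) \<in> borel_measurable (lebesgue_on {0..})"
    by (intro measurable_restrict_space1 measurable_completion)
  moreover have "(\<lambda>t. (norm (h t))\<^sup>2) absolutely_integrable_on {0..T}"
    by (intro absolutely_integrable_continuous_real continuous_intros h_cont)
  then have "set_integrable lebesgue {0..} (\<lambda>t. (norm (indicator {..T} t *\<^sub>R h t))\<^sup>2)"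
    unfolding set_integrable_def
    by (rule Bochner_Integration.integrable_cong[THEN iffD1, rotated 2])
      (auto simp: indicator_def)
  ultimately show ?thesis
    by (simp add: in_L2_def u)
qed

text \<open>
  Adding the energies of the real and imaginary parts removes the oscillation, so the total is
  exactly proportional to \<open>T\<close>.
\<close>

lemma pulse_energy:
  fixes v :: "complex^'m"
  assumes "T \<ge> 0"
  shows "(L2_norm (\<lambda>t. vmap Re (pulse \<omega> T v t)))\<^sup>2 + (L2_norm (\<lambda>t. vmap Im (pulse \<omega> T v t)))\<^sup>2
    = T * (norm v)\<^sup>2"
proof -
  have Re: "set_integrable lebesgue {0..} (\<lambda>t. (norm (vmap Re (pulse \<omega> T v t)))\<^sup>2)"
    using pulse_in_L2[OF bounded_linear_Re] unfolding in_L2_def by (rule conjunct2)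
  have Im: "set_integrable lebesgue {0..} (\<lambda>t. (norm (vmap Im (pulse \<omega> T v t)))\<^sup>2)"
    using pulse_in_L2[OF bounded_linear_Im] unfolding in_L2_def by (rule conjunct2)
  have "(L2_norm (\<lambda>t. vmap Re (pulse \<omega> T v t)))\<^sup>2 + (L2_norm (\<lambda>t. vmap Im (pulse \<omega> T v t)))\<^sup>2
      = (LINT t:{0..}|lebesgue. (norm (pulse \<omega> T v t))\<^sup>2)"
    unfolding L2_norm_squared set_integral_add(2)[OF Re Im, symmetric] norm_vmap_Re_Im ..
  also have "\<dots> = (LINT t:{0..T}|lebesgue. (norm v)\<^sup>2)"
    unfolding set_lebesgue_integral_def
    by (rule Bochner_Integration.integral_cong) (auto simp: indicator_def pulse_def norm_smult)
  also have "\<dots> = T * (norm v)\<^sup>2"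
    using assms by (simp add: set_integral_const)
  finally show ?thesis .
qed

lemma energy_lower_bound:
  fixes D :: "real \<Rightarrow> complex^'p"
  assumes L2: "in_L2 (\<lambda>t. vmap Re (D t))" "in_L2 (\<lambda>t. vmap Im (D t))"
    and close: "\<And>t. t \<in> {0..T} \<Longrightarrow> norm (D t - cis (\<omega> * t) *s w) \<le> r t"
    and r: "(r has_integral R) {0..T}" and "T \<ge> 0"
  shows "T * (norm w)\<^sup>2 - 2 * norm w * R
    \<le> (L2_norm (\<lambda>t. vmap Re (D t)))\<^sup>2 + (L2_norm (\<lambda>t. vmap Im (D t)))\<^sup>2"
proof -
  have "set_integrable lebesgue {0..} (\<lambda>t. (norm (vmap Re (D t)))\<^sup>2)"
    "set_integrable lebesgue {0..} (\<lambda>t. (norm (vmap Im (D t)))\<^sup>2)"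
    using L2 by (auto simp: in_L2_def)
  then have D_int: "set_integrable lebesgue {0..} (\<lambda>t. (norm (D t))\<^sup>2)"
    and "(L2_norm (\<lambda>t. vmap Re (D t)))\<^sup>2 + (L2_norm (\<lambda>t. vmap Im (D t)))\<^sup>2
      = (LINT t:{0..}|lebesgue. (norm (D t))\<^sup>2)"
    using set_integral_add[of lebesgue "{0..}" "\<lambda>t. (norm (vmap Re (D t)))\<^sup>2" "\<lambda>t. (norm (vmap Im (D t)))\<^sup>2"]
    by (simp_all add: L2_norm_squared norm_vmap_Re_Im)
  then have energy: "(L2_norm (\<lambda>t. vmap Re (D t)))\<^sup>2 + (L2_norm (\<lambda>t. vmap Im (D t)))\<^sup>2
      = integral {0..} (\<lambda>t. (norm (D t))\<^sup>2)"
    by (simp add: set_lebesgue_integral_eq_integral)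
  have int0: "(\<lambda>t. (norm (D t))\<^sup>2) integrable_on {0..}"
    using D_int by (rule set_lebesgue_integral_eq_integral)
  have intT: "(\<lambda>t. (norm (D t))\<^sup>2) integrable_on {0..T}"
    using set_integrable_subset[OF D_int, of "{0..T}"] by (intro set_lebesgue_integral_eq_integral) auto
  have "((\<lambda>t. (norm w)\<^sup>2 - 2 * norm w * r t) has_integral (norm w)\<^sup>2 * (T - 0) - 2 * norm w * R) {0..T}"
    using has_integral_const_real[of "(norm w)\<^sup>2" 0 T] \<open>T \<ge> 0\<close>
    by (intro has_integral_diff has_integral_mult_right r) (simp add: mult.commute)
  then have "(norm w)\<^sup>2 * (T - 0) - 2 * norm w * R \<le> integral {0..T} (\<lambda>t. (norm (D t))\<^sup>2)"
  proof (rule has_integral_le[OF _ integrable_integral[OF intT]])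
    fix t assume t: "t \<in> {0..T}"
    \<comment> \<open>With \<open>a\<close>, \<open>d\<close> the norms of \<open>w\<close> and \<open>D t\<close>, and \<open>a - d \<le> r t\<close>:
      \<open>a\<^sup>2 - 2 a (a - d) = d\<^sup>2 - (a - d)\<^sup>2\<close>.\<close>
    have "norm w - norm (D t) \<le> norm (D t - cis (\<omega> * t) *s w)"
      using norm_triangle_ineq2[of "cis (\<omega> * t) *s w" "D t"]
      by (simp add: norm_smult norm_minus_commute)
    also have "\<dots> \<le> r t"
      using close t by blast
    finally have *: "norm w - norm (D t) \<le> r t" .
    have "(norm w)\<^sup>2 - 2 * norm w * r t \<le> (norm w)\<^sup>2 - 2 * norm w * (norm w - norm (D t))"
      using mult_left_mono[OF *, of "2 * norm w"] by simp
    also have "\<dots> = (norm (D t))\<^sup>2 - (norm w - norm (D t))\<^sup>2"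
      by (simp add: power2_eq_square algebra_simps)
    also have "\<dots> \<le> (norm (D t))\<^sup>2"
      by simp
    finally show "(norm w)\<^sup>2 - 2 * norm w * r t \<le> (norm (D t))\<^sup>2" .
  qed
  also have "\<dots> \<le> integral {0..} (\<lambda>t. (norm (D t))\<^sup>2)"
    by (rule integral_subset_le[OF _ intT int0]) auto
  finally show ?thesis
    by (simp add: energy mult.commute)
qed

lemma has_integral_decaying_exp:
  fixes K b T :: real
  assumes "b > 0" "T \<ge> 0"
  shows "((\<lambda>t. K * exp (- b * t)) has_integral (K / b * (1 - exp (- b * T)))) {0..T}"
proof -
  have "((\<lambda>t. K * exp (- b * t)) has_integral (- K / b * exp (- b * T)) - (- K / b * exp (- b * 0))) {0..T}"
    using \<open>T \<ge> 0\<close>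
  proof (rule fundamental_theorem_of_calculus)
    fix t assume "t \<in> {0..T}"
    show "((\<lambda>t. - K / b * exp (- b * t)) has_vector_derivative K * exp (- b * t)) (at t within {0..T})"
      using \<open>b > 0\<close> unfolding has_real_derivative_iff_has_vector_derivative[symmetric]
      by (auto intro!: derivative_eq_intros)
  qed
  then show ?thesis
    by (simp add: algebra_simps)
qed

lemma pulse_diff: "pulse \<omega> T v1 t - pulse \<omega> T v2 t = pulse \<omega> T (v1 - v2) t"
  by (simp add: pulse_def vector_ssub_ldistrib)

text \<open>
  The similarity inequality carries over to the transfer functions on the imaginary axis, pointwise
  in the frequency and for arbitrary pairs of complex input directions.
\<close>

lemma frequency_domain_similarity:
  fixes A1 :: "real^'n1^'n1" and B1 :: "real^'m^'n1" and C1 :: "real^'n1^'p"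
    and A2 :: "real^'n2^'n2" and B2 :: "real^'m^'n2" and C2 :: "real^'n2^'p"
  assumes hurwitz: "hurwitz A1" "hurwitz A2"
    and "similar \<gamma> \<delta> (A2, B2, C2) (A1, B1, C1)"
  obtains \<epsilon> where "\<epsilon> > 0"
    "\<And>\<omega> v1 v2. (norm (transfer_function (A1, B1, C1) (\<i> * complex_of_real \<omega>) *v v1
        - transfer_function (A2, B2, C2) (\<i> * complex_of_real \<omega>) *v v2))\<^sup>2
      \<le> \<gamma> * (norm (v1 - v2))\<^sup>2 + (\<delta> - \<epsilon>) * ((norm v1)\<^sup>2 + (norm v2)\<^sup>2)"
proof -
  obtain \<epsilon> where "\<epsilon> > 0" and sim: "\<And>u1 u2 y1 y2. in_L2 u1 \<Longrightarrow> in_L2 u2 \<Longrightarrow>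
      lti_output (A1, B1, C1) 0 0 u1 y1 \<Longrightarrow> lti_output (A2, B2, C2) 0 0 u2 y2 \<Longrightarrow>
      in_L2 (\<lambda>t. y1 t - y2 t) \<and>
      (L2_norm (\<lambda>t. y1 t - y2 t))\<^sup>2
        \<le> \<gamma> * (L2_norm (\<lambda>t. u1 t - u2 t))\<^sup>2 + (\<delta> - \<epsilon>) * (L2_norm (\<lambda>t. (u1 t, u2 t)))\<^sup>2"
    using assms(3) unfolding similar_def by blast
  have "(norm (transfer_function (A1, B1, C1) (\<i> * complex_of_real \<omega>) *v v1
        - transfer_function (A2, B2, C2) (\<i> * complex_of_real \<omega>) *v v2))\<^sup>2
      \<le> \<gamma> * (norm (v1 - v2))\<^sup>2 + (\<delta> - \<epsilon>) * ((norm v1)\<^sup>2 + (norm v2)\<^sup>2)" for \<omega> v1 v2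
  proof -
    define w1 where "w1 = transfer_function (A1, B1, C1) (\<i> * complex_of_real \<omega>) *v v1"
    define w2 where "w2 = transfer_function (A2, B2, C2) (\<i> * complex_of_real \<omega>) *v v2"
    define c where "c = \<gamma> * (norm (v1 - v2))\<^sup>2 + (\<delta> - \<epsilon>) * ((norm v1)\<^sup>2 + (norm v2)\<^sup>2)"
    obtain K1 b1 where K1: "b1 > 0" "K1 \<ge> 0"
      "\<And>T. T \<ge> 0 \<Longrightarrow> \<exists>Y. (\<forall>L. bounded_linear L \<longrightarrow>
              lti_output (A1, B1, C1) 0 0 (\<lambda>t. vmap L (pulse \<omega> T v1 t)) (\<lambda>t. vmap L (Y t))) \<and>
           (\<forall>t\<in>{0..T}. norm (Y t - cis (\<omega> * t) *s w1) \<le> K1 * exp (- b1 * t))"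
      unfolding w1_def by (rule pulse_response[OF hurwitz(1), where \<omega> = \<omega> and v = v1]) blast
    obtain K2 b2 where K2: "b2 > 0" "K2 \<ge> 0"
      "\<And>T. T \<ge> 0 \<Longrightarrow> \<exists>Y. (\<forall>L. bounded_linear L \<longrightarrow>
              lti_output (A2, B2, C2) 0 0 (\<lambda>t. vmap L (pulse \<omega> T v2 t)) (\<lambda>t. vmap L (Y t))) \<and>
           (\<forall>t\<in>{0..T}. norm (Y t - cis (\<omega> * t) *s w2) \<le> K2 * exp (- b2 * t))"
      unfolding w2_def by (rule pulse_response[OF hurwitz(2), where \<omega> = \<omega> and v = v2]) blast
    define R where "R = K1 / b1 + K2 / b2"
    have main: "T * ((norm (w1 - w2))\<^sup>2 - c) \<le> 2 * norm (w1 - w2) * R" if T: "T \<ge> 0" for T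
    proof -
      obtain Y1 where Y1: "\<And>L. bounded_linear L \<Longrightarrow>
          lti_output (A1, B1, C1) 0 0 (\<lambda>t. vmap L (pulse \<omega> T v1 t)) (\<lambda>t. vmap L (Y1 t))"
        "\<And>t. t \<in> {0..T} \<Longrightarrow> norm (Y1 t - cis (\<omega> * t) *s w1) \<le> K1 * exp (- b1 * t)"
        using K1(3)[OF T] by blast
      obtain Y2 where Y2: "\<And>L. bounded_linear L \<Longrightarrow>
          lti_output (A2, B2, C2) 0 0 (\<lambda>t. vmap L (pulse \<omega> T v2 t)) (\<lambda>t. vmap L (Y2 t))"
        "\<And>t. t \<in> {0..T} \<Longrightarrow> norm (Y2 t - cis (\<omega> * t) *s w2) \<le> K2 * exp (- b2 * t)"
        using K2(3)[OF T] by blast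
      have step: "in_L2 (\<lambda>t. vmap L (Y1 t - Y2 t)) \<and>
          (L2_norm (\<lambda>t. vmap L (Y1 t - Y2 t)))\<^sup>2
            \<le> \<gamma> * (L2_norm (\<lambda>t. vmap L (pulse \<omega> T (v1 - v2) t)))\<^sup>2
              + (\<delta> - \<epsilon>) * ((L2_norm (\<lambda>t. vmap L (pulse \<omega> T v1 t)))\<^sup>2 + (L2_norm (\<lambda>t. vmap L (pulse \<omega> T v2 t)))\<^sup>2)"
        if L: "bounded_linear L" for L
      proof -
        have diff: "vmap L x - vmap L y = vmap L (x - y)" for x y :: "complex^'a"
          by (rule linear_diff[OF bounded_linear.linear[OF bounded_linear_vmap[OF L]], symmetric])
        from sim[OF pulse_in_L2[OF L] pulse_in_L2[OF L] Y1(1)[OF L] Y2(1)[OF L]] show ?thesis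
          by (simp add: L2_norm_squared_Pair[OF pulse_in_L2[OF L] pulse_in_L2[OF L]] diff pulse_diff)
      qed
      have close: "norm ((Y1 t - Y2 t) - cis (\<omega> * t) *s (w1 - w2))
          \<le> K1 * exp (- b1 * t) + K2 * exp (- b2 * t)" if "t \<in> {0..T}" for t
        using norm_triangle_ineq4[of "Y1 t - cis (\<omega> * t) *s w1" "Y2 t - cis (\<omega> * t) *s w2"]
          Y1(2)[OF that] Y2(2)[OF that]
        by (simp add: vector_ssub_ldistrib algebra_simps)
      define R' where "R' = K1 / b1 * (1 - exp (- b1 * T)) + K2 / b2 * (1 - exp (- b2 * T))"
      have R': "((\<lambda>t. K1 * exp (- b1 * t) + K2 * exp (- b2 * t)) has_integral R') {0..T}"
        unfolding R'_def using K1 K2 T by (intro has_integral_add has_integral_decaying_exp)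
      have "K1 / b1 * (1 - exp (- b1 * T)) \<le> K1 / b1" "K2 / b2 * (1 - exp (- b2 * T)) \<le> K2 / b2"
        using K1(1,2) K2(1,2) by (intro mult_left_le; simp)+
      then have "R' \<le> R"
        unfolding R'_def R_def by linarith
      then have "2 * norm (w1 - w2) * R' \<le> 2 * norm (w1 - w2) * R"
        by (intro mult_left_mono) auto
      moreover have "T * (norm (w1 - w2))\<^sup>2 - 2 * norm (w1 - w2) * R'
          \<le> (L2_norm (\<lambda>t. vmap Re (Y1 t - Y2 t)))\<^sup>2 + (L2_norm (\<lambda>t. vmap Im (Y1 t - Y2 t)))\<^sup>2"
        using step[OF bounded_linear_Re] step[OF bounded_linear_Im] close R' T
        by (intro energy_lower_bound) auto
      moreover have "\<dots> \<le> \<gamma> * (T * (norm (v1 - v2))\<^sup>2) + (\<delta> - \<epsilon>) * (T * (norm v1)\<^sup>2 + T * (norm v2)\<^sup>2)"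
        using step[OF bounded_linear_Re] step[OF bounded_linear_Im]
        unfolding pulse_energy[OF T, of \<omega>, symmetric] by (simp add: algebra_simps)
      moreover have "\<dots> = T * c"
        by (simp add: c_def algebra_simps)
      ultimately show ?thesis
        by (simp add: algebra_simps)
    qed
    have "(norm (w1 - w2))\<^sup>2 \<le> c"
    proof (rule ccontr)
      assume "\<not> ?thesis"
      then have pos: "(norm (w1 - w2))\<^sup>2 - c > 0"
        by simp
      have "R \<ge> 0"
        using K1 K2 by (simp add: R_def)
      then have "2 * norm (w1 - w2) * R + 1 > 0"
        by (simp add: add_nonneg_pos)
      \<comment> \<open>The left-hand side of \<open>main\<close> would grow linearly in \<open>T\<close>; this \<open>T\<close> exceeds the bound by 1.\<close>
      then show False
        using main[of "(2 * norm (w1 - w2) * R + 1) / ((norm (w1 - w2))\<^sup>2 - c)"] pos by simp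
    qed
    then show ?thesis
      by (simp add: w1_def w2_def c_def)
  qed
  with \<open>\<epsilon> > 0\<close> show ?thesis
    using that by blast
qed

section \<open>The largest singular value\<close>

text \<open>
  The inner product of complex vectors is the real one, the real part of the Hermitian product. This
  suffices because the eigenvalues of \<open>M\<^sup>* M\<close> under consideration are real.
\<close>

lemma conj_transpose_adjoint: "x \<bullet> (conj_transpose M *v y) = (M *v x) \<bullet> y"
  for M :: "complex^'n^'m"
proof -
  have "x \<bullet> (conj_transpose M *v y) = (\<Sum>i\<in>UNIV. \<Sum>j\<in>UNIV. x $ i \<bullet> (cnj (M $ j $ i) * y $ j))"
    by (simp add: inner_vec_def conj_transpose_def matrix_vector_mult_def transpose_def inner_sum_right)
  also have "\<dots> = (\<Sum>j\<in>UNIV. \<Sum>i\<in>UNIV. (M $ j $ i * x $ i) \<bullet> y $ j)"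
    by (subst sum.swap) (simp add: inner_complex_def algebra_simps)
  also have "\<dots> = (M *v x) \<bullet> y"
    by (simp add: inner_vec_def matrix_vector_mult_def inner_sum_left)
  finally show ?thesis .
qed

lemma gram_adjoint: "x \<bullet> ((conj_transpose M ** M) *v y) = (M *v x) \<bullet> (M *v y)"
  by (simp add: conj_transpose_adjoint flip: matrix_vector_mul_assoc)

lemma of_real_smult: "complex_of_real r *s v = r *\<^sub>R v"
  by (simp add: vec_eq_iff flip: scaleR_conv_of_real)

lemma gram_eigenvector_orthogonal:
  assumes "(conj_transpose M ** M) *v x = a *\<^sub>R x" "(conj_transpose M ** M) *v y = b *\<^sub>R y" "a \<noteq> b"
  shows "orthogonal x y"
proof -
  have "b * (x \<bullet> y) = (M *v x) \<bullet> (M *v y)"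
    by (simp add: assms(2) flip: gram_adjoint)
  also have "\<dots> = a * (x \<bullet> y)"
    using gram_adjoint[of y M x] by (simp add: assms(1) inner_commute)
  finally show ?thesis
    using \<open>a \<noteq> b\<close> by (simp add: orthogonal_def)
qed

lemma singular_values_iff:
  "\<sigma> \<in> singular_values M \<longleftrightarrow> \<sigma> \<ge> 0 \<and> (\<exists>v. v \<noteq> 0 \<and> (conj_transpose M ** M) *v v = \<sigma>\<^sup>2 *\<^sub>R v)"
  unfolding singular_values_def eigenvalue_def of_real_smult by simp

text \<open>Eigenvectors of \<open>M\<^sup>* M\<close> for distinct singular values are orthogonal, hence independent.\<close>

lemma finite_singular_values: "finite (singular_values M)"
proof -
  define v where "v \<sigma> = (SOME v. v \<noteq> 0 \<and> (conj_transpose M ** M) *v v = \<sigma>\<^sup>2 *\<^sub>R v)" for \<sigma>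
  have v: "v \<sigma> \<noteq> 0" "(conj_transpose M ** M) *v v \<sigma> = \<sigma>\<^sup>2 *\<^sub>R v \<sigma>" if "\<sigma> \<in> singular_values M" for \<sigma>
    using that someI_ex[of "\<lambda>v. v \<noteq> 0 \<and> (conj_transpose M ** M) *v v = \<sigma>\<^sup>2 *\<^sub>R v"]
    unfolding singular_values_iff v_def by blast+
  have orth: "orthogonal (v \<sigma>) (v \<tau>)"
    if "\<sigma> \<in> singular_values M" "\<tau> \<in> singular_values M" "\<sigma> \<noteq> \<tau>" for \<sigma> \<tau>
  proof (rule gram_eigenvector_orthogonal)
    show "\<sigma>\<^sup>2 \<noteq> \<tau>\<^sup>2"
      using that by (simp add: singular_values_iff power2_eq_iff_nonneg)
  qed (use v that in auto)
  have "inj_on v (singular_values M)"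
    using orth v(1) by (metis inj_onI orthogonal_self)
  moreover have "independent (v ` singular_values M)"
    using orth v(1) by (intro pairwise_orthogonal_independent) (auto simp: pairwise_def)
  ultimately show ?thesis
    using independent_imp_finite finite_imageD by blast
qed

text \<open>The maximum of \<open>norm (M v)\<close> over the unit sphere is a singular value.\<close>

lemma singular_values_nonempty: "singular_values M \<noteq> {}"
  for M :: "complex^'n^'m"
proof -
  have M_cont: "continuous_on S (\<lambda>v. norm (M *v v))" for S
    by (intro continuous_intros bounded_linear.continuous_on[OF matrix_vector_mul_bounded_linear])
  have "sphere (0 :: complex^'n) 1 \<noteq> {}"
    using vector_choose_size[of 1, where 'a = "complex^'n"] by (auto simp: dist_norm)
  then obtain v where "v \<in> sphere (0 :: complex^'n) 1"
    "\<forall>x\<in>sphere 0 1. norm (M *v x) \<le> norm (M *v v)"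
    using continuous_attains_sup[OF compact_sphere _ M_cont] by blast
  then have v: "norm v = 1" and max: "\<And>x. norm x = 1 \<Longrightarrow> norm (M *v x) \<le> norm (M *v v)"
    by auto
  define \<sigma> where "\<sigma> = norm (M *v v)"
  have M_le: "norm (M *v x) \<le> \<sigma> * norm x" for x
  proof (cases "x = 0")
    case False
    have "norm (M *v ((1 / norm x) *\<^sub>R x)) \<le> \<sigma>"
      unfolding \<sigma>_def using False by (intro max) simp
    then show ?thesis
      using False by (simp add: linear_cmul[OF matrix_vector_mul_linear] divide_le_eq)
  qed simp
  define q where "q x = \<sigma>\<^sup>2 * (x \<bullet> x) - (M *v x) \<bullet> (M *v x)" for x
  have q_nonneg: "q x \<ge> 0" for x
    using power_mono[OF M_le[of x], of 2] by (simp add: q_def power_mult_distrib power2_norm_eq_inner)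
  \<comment> \<open>The form \<open>q\<close> is positive semidefinite and vanishes at \<open>v\<close>, so \<open>v\<close> lies in its kernel.\<close>
  have q_v: "q v = 0"
    using v by (simp add: q_def \<sigma>_def flip: power2_norm_eq_inner)
  define h where "h = \<sigma>\<^sup>2 *\<^sub>R v - (conj_transpose M ** M) *v v"
  have q_line: "q (v - t *\<^sub>R h) = t\<^sup>2 * q h - 2 * t * (h \<bullet> h)" for t
  proof -
    have "h \<bullet> h = \<sigma>\<^sup>2 * (h \<bullet> v) - (M *v h) \<bullet> (M *v v)"
      unfolding gram_adjoint[symmetric] by (subst (2) h_def) (simp add: inner_diff_right)
    moreover have "q (v - t *\<^sub>R h) = q v + t\<^sup>2 * q h - 2 * t * (\<sigma>\<^sup>2 * (h \<bullet> v) - (M *v h) \<bullet> (M *v v))"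
      by (simp add: q_def matrix_vector_mult_diff_distrib linear_cmul[OF matrix_vector_mul_linear] inner_diff_left
          inner_diff_right inner_commute power2_eq_square algebra_simps)
    ultimately show ?thesis
      by (simp add: q_v)
  qed
  have ineq: "2 * t * (h \<bullet> h) \<le> t\<^sup>2 * q h" for t
    using q_nonneg[of "v - t *\<^sub>R h"] q_line[of t] by linarith
  have "h \<bullet> h = 0"
  proof (cases "q h = 0")
    case True
    then show ?thesis
      using ineq[of 1] inner_ge_zero[of h] by simp
  next
    case False
    then have "q h > 0"
      using q_nonneg[of h] by simp
    \<comment> \<open>This value of \<open>t\<close> minimises \<open>q (v - t h)\<close>.\<close>
    have "2 * (h \<bullet> h / q h) * (h \<bullet> h) \<le> (h \<bullet> h / q h)\<^sup>2 * q h"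
      by (rule ineq)
    then have "2 * (h \<bullet> h)\<^sup>2 \<le> (h \<bullet> h)\<^sup>2"
      using \<open>q h > 0\<close> by (simp add: power2_eq_square field_simps)
    then show ?thesis
      by simp
  qed
  then have "(conj_transpose M ** M) *v v = \<sigma>\<^sup>2 *\<^sub>R v"
    by (simp add: h_def)
  moreover have "v \<noteq> 0"
    using v by auto
  ultimately have "\<sigma> \<in> singular_values M"
    by (auto simp: singular_values_iff \<sigma>_def)
  then show ?thesis
    by blast
qed

lemma sigma_max_le:
  assumes bound: "\<And>v. (norm (M *v v))\<^sup>2 \<le> k * (norm v)\<^sup>2"
  shows "sigma_max M \<le> sqrt k"
proof -
  have "sigma_max M \<in> singular_values M"
    unfolding sigma_max_def by (intro Max_in finite_singular_values singular_values_nonempty)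
  then obtain v where v: "v \<noteq> 0" "(conj_transpose M ** M) *v v = (sigma_max M)\<^sup>2 *\<^sub>R v"
    by (auto simp: singular_values_iff)
  have "(norm (M *v v))\<^sup>2 = (sigma_max M)\<^sup>2 * (norm v)\<^sup>2"
    by (simp add: power2_norm_eq_inner v(2) flip: gram_adjoint)
  then have "(sigma_max M)\<^sup>2 \<le> k"
    using bound[of v] v(1) by simp
  then show ?thesis
    by (rule real_le_rsqrt)
qed

lemma hinf_norm_less:
  assumes "\<And>\<omega> v. (norm (G (\<i> * complex_of_real \<omega>) *v v))\<^sup>2 \<le> k * (norm v)\<^sup>2" and "k < c"
  shows "hinf_norm G < ereal (sqrt c)"
proof -
  have "hinf_norm G \<le> ereal (sqrt k)"
    unfolding hinf_norm_def using assms(1) by (intro SUP_least) (simp add: sigma_max_le)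
  also have "\<dots> < ereal (sqrt c)"
    using assms(2) by simp
  finally show ?thesis .
qed

section \<open>Symmetry of similarity and the norm bounds\<close>

lemma in_L2_minus_commute: "in_L2 (\<lambda>t. f t - g t) \<longleftrightarrow> in_L2 (\<lambda>t. g t - f t)"
  for f g :: "real \<Rightarrow> 'a::euclidean_space"
proof -
  have "in_L2 (\<lambda>t. g t - f t)" if "in_L2 (\<lambda>t. f t - g t)" for f g :: "real \<Rightarrow> 'a"
    using that borel_measurable_uminus[of "\<lambda>t. f t - g t" "lebesgue_on {0..}"]
    by (simp add: in_L2_def norm_minus_commute)
  then show ?thesis
    by blast
qed

lemma similar_sym:
  fixes \<Sigma>1 :: "('n1::finite, 'm::finite, 'p::finite) lti" and \<Sigma>2 :: "('n2::finite, 'm, 'p) lti"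
  assumes "similar \<gamma> \<delta> \<Sigma>2 \<Sigma>1"
  shows "similar \<gamma> \<delta> \<Sigma>1 \<Sigma>2"
proof -
  have diff: "L2_norm (\<lambda>t. f t - g t) = L2_norm (\<lambda>t. g t - f t)" for f g :: "real \<Rightarrow> real^'k"
    by (simp add: L2_norm_def norm_minus_commute)
  have pair: "L2_norm (\<lambda>t. (f t, g t)) = L2_norm (\<lambda>t. (g t, f t))" for f g :: "real \<Rightarrow> real^'m"
    by (simp add: L2_norm_def norm_Pair add.commute)
  obtain \<epsilon> where "\<epsilon> > 0" and sim: "\<And>u1 u2 y1 y2. in_L2 u1 \<Longrightarrow> in_L2 u2 \<Longrightarrow>
      lti_output \<Sigma>1 0 0 u1 y1 \<Longrightarrow> lti_output \<Sigma>2 0 0 u2 y2 \<Longrightarrow>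
      in_L2 (\<lambda>t. y1 t - y2 t) \<and>
      (L2_norm (\<lambda>t. y1 t - y2 t))\<^sup>2
        \<le> \<gamma> * (L2_norm (\<lambda>t. u1 t - u2 t))\<^sup>2 + (\<delta> - \<epsilon>) * (L2_norm (\<lambda>t. (u1 t, u2 t)))\<^sup>2"
    using assms unfolding similar_def by blast
  show ?thesis
    unfolding similar_def
  proof (intro exI[of _ \<epsilon>] conjI \<open>\<epsilon> > 0\<close> allI impI)
    fix u2 u1 y2 y1
    assume "in_L2 u2" "in_L2 u1" "lti_output \<Sigma>2 0 0 u2 y2" "lti_output \<Sigma>1 0 0 u1 y1"
    note * = sim[OF \<open>in_L2 u1\<close> \<open>in_L2 u2\<close> \<open>lti_output \<Sigma>1 0 0 u1 y1\<close> \<open>lti_output \<Sigma>2 0 0 u2 y2\<close>]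
    show "in_L2 (\<lambda>t. y2 t - y1 t)"
      using * by (subst in_L2_minus_commute) (rule conjunct1)
    show "(L2_norm (\<lambda>t. y2 t - y1 t))\<^sup>2
        \<le> \<gamma> * (L2_norm (\<lambda>t. u2 t - u1 t))\<^sup>2 + (\<delta> - \<epsilon>) * (L2_norm (\<lambda>t. (u2 t, u1 t)))\<^sup>2"
      unfolding diff[of y2] diff[of u2] pair[of u2] using * by (rule conjunct2)
  qed
qed

theorem proposition3:
  fixes A1 :: "real^'n1^'n1" and B1 :: "real^'m^'n1" and C1 :: "real^'n1^'p"
    and A2 :: "real^'n2^'n2" and B2 :: "real^'m^'n2" and C2 :: "real^'n2^'p"
    and G1 G2 :: "complex \<Rightarrow> complex^'m^'p"
    and \<gamma> \<delta> :: real
  assumes "hurwitz A1" and "hurwitz A2"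
    and "G1 = transfer_function (A1, B1, C1)" and "G2 = transfer_function (A2, B2, C2)"
    and "\<gamma> > 0" and "\<delta> > 0"
  shows "(similar \<gamma> \<delta> (A2, B2, C2) (A1, B1, C1) \<longleftrightarrow> similar \<gamma> \<delta> (A1, B1, C1) (A2, B2, C2)) \<and>
    (similar \<gamma> \<delta> (A2, B2, C2) (A1, B1, C1) \<longrightarrow>
      hinf_norm G1 < ereal (sqrt (\<gamma> + \<delta>)) \<and>
      hinf_norm G2 < ereal (sqrt (\<gamma> + \<delta>)) \<and>
      hinf_norm (\<lambda>s. G1 s - G2 s) < ereal (sqrt (2 * \<delta>)))"
proof (intro conjI impI)
  show "similar \<gamma> \<delta> (A2, B2, C2) (A1, B1, C1) \<longleftrightarrow> similar \<gamma> \<delta> (A1, B1, C1) (A2, B2, C2)"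
    by (rule iffI; erule similar_sym)
next
  assume sim: "similar \<gamma> \<delta> (A2, B2, C2) (A1, B1, C1)"
  obtain \<epsilon> where "\<epsilon> > 0" and bound: "\<And>\<omega> v1 v2.
      (norm (G1 (\<i> * complex_of_real \<omega>) *v v1 - G2 (\<i> * complex_of_real \<omega>) *v v2))\<^sup>2
        \<le> \<gamma> * (norm (v1 - v2))\<^sup>2 + (\<delta> - \<epsilon>) * ((norm v1)\<^sup>2 + (norm v2)\<^sup>2)"
    unfolding assms(3,4) by (rule frequency_domain_similarity[OF assms(1,2) sim]) blast
  show "hinf_norm G1 < ereal (sqrt (\<gamma> + \<delta>))"
  proof (rule hinf_norm_less)
    show "(norm (G1 (\<i> * complex_of_real \<omega>) *v v))\<^sup>2 \<le> (\<gamma> + \<delta> - \<epsilon>) * (norm v)\<^sup>2" for \<omega> v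
      using bound[of \<omega> v 0] by (simp add: algebra_simps)
  qed (use \<open>\<epsilon> > 0\<close> in simp)
  show "hinf_norm G2 < ereal (sqrt (\<gamma> + \<delta>))"
  proof (rule hinf_norm_less)
    show "(norm (G2 (\<i> * complex_of_real \<omega>) *v v))\<^sup>2 \<le> (\<gamma> + \<delta> - \<epsilon>) * (norm v)\<^sup>2" for \<omega> v
      using bound[of \<omega> 0 v] by (simp add: algebra_simps)
  qed (use \<open>\<epsilon> > 0\<close> in simp)
  show "hinf_norm (\<lambda>s. G1 s - G2 s) < ereal (sqrt (2 * \<delta>))"
  proof (rule hinf_norm_less)
    show "(norm ((G1 (\<i> * complex_of_real \<omega>) - G2 (\<i> * complex_of_real \<omega>)) *v v))\<^sup>2
        \<le> (2 * (\<delta> - \<epsilon>)) * (norm v)\<^sup>2" for \<omega> v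
      using bound[of \<omega> v v] by (simp add: matrix_vector_mult_diff_rdistrib algebra_simps)
  qed (use \<open>\<epsilon> > 0\<close> in simp)
qed

end
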